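(* Let $R$ be an integral domain of characteristic $0$ with fraction field $K$, and let $p$ be a prime such that $a^p\equiv a \pmod{pR}$ for all $a\in R$. Let $$\varphi(x)\in x^p+p\,x^{p+1}R[[x]].$$ Let $f_\varphi(x)\in x+x^2K[[x]]$ be the Böttcher coordinate of $\varphi$, i.e. the unique such power series satisfying $\varphi(f_\varphi(x))=f_\varphi(x^p)$, and let $f_\varphi^{-1}(x)\in x+x^2K[[x]]$ be its inverse under composition. Then $$f_\varphi(x)\in R[[x]]\quad\text{and}\quad f_\varphi^{-1}(x)\in R[[x]].$$
   Context: Existence and uniqueness of the Böttcher coordinate (well known): if $K$ is a field of characteristic $0$, $m\ge2$, and $\varphi(x)\in x^m+x^{m+1}K[[x]]$, then there is a unique formal power series $f_\varphi(x)\in x+x^2K[[x]]$ with $\varphi\circ f_\varphi(x)=f_\varphi(x^m)$; it is called the (local) Böttcher coordinate of $\varphi$. Here it is used with $m=p$. Examples of admissible rings $R$ are $\mathbb{Z}$ and $\mathbb{Z}_p$. *)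

theory Defs
  imports "HOL-Computational_Algebra.Computational_Algebra"
begin

instance fract :: ("{idom,ring_char_0}") field_char_0
proof
  have of_nat: "of_nat n = to_fract (of_nat n :: 'a)" for n
    by (induction n) simp_all
  show "inj (of_nat :: nat \<Rightarrow> 'a fract)"
    by (rule injI) (simp add: of_nat)
qed

text \<open>The inclusion of \<open>R[[x]]\<close> into \<open>K[[x]]\<close>, where \<open>K\<close> is the fraction field of \<open>R\<close>.\<close>

definition fps_to_fract :: "'a::idom fps \<Rightarrow> 'a fract fps" where
  "fps_to_fract f = Abs_fps (\<lambda>n. to_fract (fps_nth f n))"

definition is_bottcher :: "nat \<Rightarrow> 'k::field_char_0 fps \<Rightarrow> 'k fps \<Rightarrow> bool" where
  "is_bottcher m \<phi> f \<longleftrightarrow>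
     fps_nth f 0 = 0 \<and> fps_nth f 1 = 1 \<and> \<phi> oo f = f oo fps_X ^ m"

text \<open>Meaningful for \<open>m \<ge> 2\<close> and \<open>\<phi> \<in> x^m + x^(m+1) K[[x]]\<close>, where the description is
  proper by \<open>ex1_is_bottcher\<close> below.\<close>

definition bottcher :: "nat \<Rightarrow> 'k::field_char_0 fps \<Rightarrow> 'k fps" where
  "bottcher m \<phi> = (THE f. is_bottcher m \<phi> f)"

context
  fixes m :: nat and \<psi> :: "'k::field_char_0 fps"
  assumes m: "m \<ge> 2" and \<psi>0: "fps_nth \<psi> 0 = 1"
begin

private definition defect :: "'k fps \<Rightarrow> 'k fps" where
  "defect u = u ^ m * (\<psi> oo (fps_X * u)) - (u oo fps_X ^ m)"

private definition improve :: "'k fps \<Rightarrow> 'k fps" where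
  "improve u = u - fps_const (1 / of_nat m) * defect u"

private definition agree :: "nat \<Rightarrow> 'k fps \<Rightarrow> 'k fps \<Rightarrow> bool" where
  "agree n u v \<longleftrightarrow> (\<forall>k<n. fps_nth u k = fps_nth v k)"

private lemma agree_mult: "agree n u v \<Longrightarrow> agree n u' v' \<Longrightarrow> agree n (u * u') (v * v')"
  by (auto simp: agree_def fps_mult_nth intro!: sum.cong)

private lemma agree_power: "agree n u v \<Longrightarrow> agree n (u ^ i) (v ^ i)"
proof (induction i)
  case (Suc i)
  thus ?case by (simp add: agree_mult)
qed (simp add: agree_def)

private lemma agree_diff: "agree n u v \<longleftrightarrow> (\<exists>w. u - v = fps_X ^ n * w)"
proof
  assume *: "agree n u v"
  have "u - v = fps_X ^ n * fps_shift n (u - v)"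
    using * by (auto simp: fps_eq_iff fps_X_power_mult_nth agree_def)
  thus "\<exists>w. u - v = fps_X ^ n * w" ..
next
  assume "\<exists>w. u - v = fps_X ^ n * w"
  then obtain w where w: "u - v = fps_X ^ n * w" ..
  have "fps_nth (u - v) k = 0" if "k < n" for k
    using that by (simp add: w fps_X_power_mult_nth)
  thus "agree n u v" by (simp add: agree_def)
qed

private lemma power_diff_nth:
  assumes "agree n u v" "fps_nth u 0 = 1" "fps_nth v 0 = 1"
  shows "fps_nth (u ^ i) n - fps_nth (v ^ i) n = of_nat i * (fps_nth u n - fps_nth v n)"
proof (induction i)
  case (Suc i)
  obtain w where w: "u - v = fps_X ^ n * w"
    using assms(1) agree_diff by blast
  obtain w' where w': "u ^ i - v ^ i = fps_X ^ n * w'"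
    using agree_power[OF assms(1)] agree_diff by blast
  have "u ^ Suc i - v ^ Suc i = (u - v) * u ^ i + (u ^ i - v ^ i) * v"
    by (simp add: algebra_simps)
  also have "\<dots> = fps_X ^ n * (w * u ^ i) + fps_X ^ n * (w' * v)"
    by (simp add: w w' mult.assoc)
  finally have "fps_nth (u ^ Suc i - v ^ Suc i) n = fps_nth w 0 + fps_nth w' 0"
    using assms by (simp add: fps_X_power_mult_nth fps_power_zeroth)
  moreover have "fps_nth (u - v) n = fps_nth w 0"
    by (simp add: w fps_X_power_mult_nth)
  moreover have "fps_nth (u ^ i - v ^ i) n = fps_nth w' 0"
    by (simp add: w' fps_X_power_mult_nth)
  ultimately show ?case using Suc by (simp add: algebra_simps)
qed simp

private lemma agree_compose:
  assumes "agree n u v"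
  shows "agree (Suc n) (\<psi> oo (fps_X * u)) (\<psi> oo (fps_X * v))"
proof -
  have "fps_nth ((fps_X * u) ^ i) k = fps_nth ((fps_X * v) ^ i) k" if "k < Suc n" for i k
  proof (cases "i = 0")
    case False
    thus ?thesis using agree_power[OF assms, of i] that
      by (auto simp: power_mult_distrib fps_X_power_mult_nth agree_def)
  qed simp
  thus ?thesis by (simp add: agree_def fps_compose_nth)
qed

private lemma agree_compose_power:
  assumes "agree n u v" "n \<ge> 1"
  shows "agree (Suc n) (u oo fps_X ^ m) (v oo fps_X ^ m)"
proof -
  have "fps_nth u i * fps_nth ((fps_X ^ m) ^ i) k = fps_nth v i * fps_nth ((fps_X ^ m) ^ i) k"
    if k: "k < Suc n" for i k
  proof (cases "i < n")
    case True
    thus ?thesis using assms by (simp add: agree_def)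
  next
    case False
    have "2 * i \<le> m * i" using m by simp
    hence "k \<noteq> m * i" using k False assms(2) by linarith
    thus ?thesis by (simp flip: power_mult)
  qed
  thus ?thesis unfolding agree_def fps_compose_nth by (intro allI impI sum.cong refl) blast
qed

private lemma defect_diff_nth:
  assumes uv: "agree n u v" "n \<ge> 1" "fps_nth u 0 = 1" "fps_nth v 0 = 1"
  shows "fps_nth (defect u) n - fps_nth (defect v) n = of_nat m * (fps_nth u n - fps_nth v n)"
proof -
  obtain w where w: "u ^ m - v ^ m = fps_X ^ n * w"
    using agree_power[OF uv(1)] agree_diff by blast
  obtain w' where w': "(\<psi> oo (fps_X * u)) - (\<psi> oo (fps_X * v)) = fps_X ^ Suc n * w'"
    using agree_compose[OF uv(1)] agree_diff by blast
  obtain w'' where w'': "(u oo fps_X ^ m) - (v oo fps_X ^ m) = fps_X ^ Suc n * w''"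
    using agree_compose_power[OF uv(1,2)] agree_diff by blast
  have "defect u - defect v =
      (u ^ m - v ^ m) * (\<psi> oo (fps_X * u))
      + v ^ m * ((\<psi> oo (fps_X * u)) - (\<psi> oo (fps_X * v)))
      - ((u oo fps_X ^ m) - (v oo fps_X ^ m))"
    by (simp add: defect_def algebra_simps)
  also have "\<dots> = fps_X ^ n * (w * (\<psi> oo (fps_X * u))) + fps_X ^ Suc n * (v ^ m * w')
      - fps_X ^ Suc n * w''"
    unfolding w w' w'' by (simp only: mult_ac)
  finally have "fps_nth (defect u - defect v) n = fps_nth w 0"
    by (simp only: fps_X_power_mult_nth fps_add_nth fps_sub_nth) (simp add: \<psi>0)
  also have "\<dots> = fps_nth (u ^ m - v ^ m) n"
    by (simp add: w fps_X_power_mult_nth)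
  also have "\<dots> = of_nat m * (fps_nth u n - fps_nth v n)"
    using power_diff_nth[OF uv(1,3,4)] by simp
  finally show ?thesis by simp
qed

private lemma improve_0: "fps_nth u 0 = 1 \<Longrightarrow> fps_nth (improve u) 0 = 1"
  by (simp add: improve_def defect_def \<psi>0 fps_power_zeroth)

private lemma agree_improve:
  assumes uv: "agree n u v" "fps_nth u 0 = 1" "fps_nth v 0 = 1"
  shows "agree (Suc n) (improve u) (improve v)"
  unfolding agree_def
proof (intro allI impI)
  fix k assume k: "k < Suc n"
  show "fps_nth (improve u) k = fps_nth (improve v) k"
  proof (cases "k = 0")
    case False
    have "agree k u v" using uv(1) k by (simp add: agree_def)
    hence "fps_nth (defect u) k - fps_nth (defect v) k = of_nat m * (fps_nth u k - fps_nth v k)"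
      using False uv by (intro defect_diff_nth) auto
    thus ?thesis using m by (simp add: improve_def field_simps)
  qed (use uv in \<open>simp add: improve_0\<close>)
qed

private lemma improve_fixed: "improve u = u \<longleftrightarrow> defect u = 0"
  using m by (simp add: improve_def)

private lemma ex1_defect: "\<exists>!u. fps_nth u 0 = 1 \<and> defect u = 0"
proof (rule ex_ex1I)
  define w where "w i = (improve ^^ i) 1" for i
  have w0: "fps_nth (w i) 0 = 1" for i
    by (induction i) (auto simp: w_def improve_0)
  have step: "agree (Suc i) (w (Suc i)) (w i)" for i
  proof (induction i)
    case 0
    show ?case using w0 by (simp add: agree_def)
  next
    case (Suc i)
    show ?case using agree_improve[OF Suc w0 w0] by (simp add: w_def)
  qed
  have far: "agree (Suc i) (w (i + j)) (w i)" for i j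
  proof (induction j)
    case (Suc j)
    thus ?case using step[of "i + j"] by (simp add: agree_def)
  qed (simp add: agree_def)
  define u where "u = Abs_fps (\<lambda>n. fps_nth (w n) n)"
  have u: "agree (Suc n) u (w n)" for n
    unfolding agree_def
  proof (intro allI impI)
    fix k assume "k < Suc n"
    thus "fps_nth u k = fps_nth (w n) k"
      using far[of k "n - k"] by (simp add: agree_def u_def)
  qed
  have u0: "fps_nth u 0 = 1" using w0[of 0] by (simp add: u_def)
  have "fps_nth (improve u) n = fps_nth u n" for n
  proof -
    have "agree (Suc (Suc n)) (improve u) (w (Suc n))"
      using agree_improve[OF u u0 w0] by (simp add: w_def)
    thus ?thesis using u[of "Suc n"] by (simp add: agree_def)
  qed
  hence "improve u = u" by (simp add: fps_eq_iff)
  thus "\<exists>u. fps_nth u 0 = 1 \<and> defect u = 0"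
    using u0 improve_fixed by blast
next
  fix u v assume u: "fps_nth u 0 = 1 \<and> defect u = 0" and v: "fps_nth v 0 = 1 \<and> defect v = 0"
  have "agree n u v" for n
  proof (induction n)
    case (Suc n)
    thus ?case using agree_improve[OF Suc] u v improve_fixed by metis
  qed (simp add: agree_def)
  thus "u = v" by (auto simp: agree_def fps_eq_iff)
qed

private lemma is_bottcher_iff_defect:
  "is_bottcher m (fps_X ^ m * \<psi>) (fps_X * u) \<longleftrightarrow> fps_nth u 0 = 1 \<and> defect u = 0"
proof -
  have m0: "fps_nth (fps_X ^ m :: 'k fps) 0 = 0" using m by simp
  have 1: "(fps_X ^ m * \<psi>) oo (fps_X * u) = fps_X ^ m * (u ^ m * (\<psi> oo (fps_X * u)))"
    by (simp add: fps_compose_mult_distrib mult.assoc power_mult_distrib flip: fps_compose_power)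
  have 2: "(fps_X * u) oo fps_X ^ m = fps_X ^ m * (u oo fps_X ^ m)"
    using m0 by (simp add: fps_compose_mult_distrib)
  have "(fps_X ^ m * \<psi>) oo (fps_X * u) = (fps_X * u) oo fps_X ^ m \<longleftrightarrow> defect u = 0"
    unfolding 1 2 defect_def by simp
  thus ?thesis by (simp add: is_bottcher_def)
qed

lemma ex1_is_bottcher_aux: "\<exists>!f. is_bottcher m (fps_X ^ m * \<psi>) f"
proof -
  have shape: "\<exists>u. f = fps_X * u" if "is_bottcher m (fps_X ^ m * \<psi>) f" for f
  proof
    show "f = fps_X * fps_shift 1 f"
      using that by (auto simp: is_bottcher_def fps_eq_iff)
  qed
  obtain u where u: "fps_nth u 0 = 1 \<and> defect u = 0"
    and uniq: "\<And>v. fps_nth v 0 = 1 \<and> defect v = 0 \<Longrightarrow> v = u"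
    using ex1_defect by metis
  show ?thesis
  proof (rule ex1I[of _ "fps_X * u"])
    show "is_bottcher m (fps_X ^ m * \<psi>) (fps_X * u)"
      using u is_bottcher_iff_defect by blast
  next
    fix f assume f: "is_bottcher m (fps_X ^ m * \<psi>) f"
    then obtain v where "f = fps_X * v" using shape by blast
    thus "f = fps_X * u" using f uniq is_bottcher_iff_defect by blast
  qed
qed

end

theorem ex1_is_bottcher:
  fixes \<phi> :: "'k::field_char_0 fps"
  assumes m: "m \<ge> 2" and \<phi>: "\<exists>g. \<phi> = fps_X ^ m + fps_X ^ (m + 1) * g"
  shows "\<exists>!f. is_bottcher m \<phi> f"
proof -
  obtain g where "\<phi> = fps_X ^ m + fps_X ^ (m + 1) * g" using \<phi> ..
  hence "\<phi> = fps_X ^ m * (1 + fps_X * g)" by (simp add: algebra_simps)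
  thus ?thesis using ex1_is_bottcher_aux[OF m, of "1 + fps_X * g"] by simp
qed

corollary is_bottcher_bottcher:
  fixes \<phi> :: "'k::field_char_0 fps"
  assumes "m \<ge> 2" and "\<exists>g. \<phi> = fps_X ^ m + fps_X ^ (m + 1) * g"
  shows "is_bottcher m \<phi> (bottcher m \<phi>)"
  unfolding bottcher_def by (rule theI'[OF ex1_is_bottcher[OF assms]])

end

theory Submission
  imports Defs
begin

text \<open>Write \<open>\<phi> = x^p + p x^(p+1) g\<close> and \<open>f = x u\<close>. The functional equation becomes
  \<open>u^p + p x u^(p+1) g(x u) = u(x^p)\<close>. Suppose the coefficients of \<open>u\<close> below \<open>n > 0\<close> are
  in \<open>R\<close>, and let \<open>v\<close> be the truncation of \<open>u\<close> before \<open>x^n\<close>. Comparing coefficients of \<open>x^n\<close>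
  expresses \<open>p u_n\<close> as the coefficient of \<open>v(x^p) - v^p - p x v^(p+1) g(x v)\<close>, and
  \<open>v^p \<equiv> v(x^p)\<close> modulo \<open>p\<close> by the Frobenius congruence in \<open>R\<close>. Hence \<open>u_n\<close> is in \<open>R\<close>.
  The coefficients of the inverse satisfy a recursion that divides only by powers of the linear
  coefficient \<open>f_1 = 1\<close>.\<close>

section \<open>The coefficientwise embedding of R[[x]] into K[[x]]\<close>

lemma to_fract_of_nat: "to_fract (of_nat n) = of_nat n"
  by (induction n) simp_all

lemma fps_to_fract_nth [simp]: "fps_nth (fps_to_fract f) n = to_fract (fps_nth f n)"
  by (simp add: fps_to_fract_def)

lemma fps_to_fract_1 [simp]: "fps_to_fract 1 = 1"
  by (simp add: fps_eq_iff fps_one_def)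

lemma fps_to_fract_X [simp]: "fps_to_fract fps_X = fps_X"
  by (simp add: fps_eq_iff fps_X_def)

lemma fps_to_fract_of_nat [simp]: "fps_to_fract (of_nat n) = of_nat n"
  by (simp add: fps_eq_iff to_fract_of_nat flip: fps_of_nat)

lemma fps_to_fract_add [simp]: "fps_to_fract (f + g) = fps_to_fract f + fps_to_fract g"
  by (simp add: fps_eq_iff)

lemma fps_to_fract_mult [simp]: "fps_to_fract (f * g) = fps_to_fract f * fps_to_fract g"
  by (simp add: fps_eq_iff fps_mult_nth)

lemma fps_to_fract_power [simp]: "fps_to_fract (f ^ n) = fps_to_fract f ^ n"
  by (induction n) simp_all

lemma fps_to_fract_compose [simp]:
  "fps_to_fract (f oo g) = fps_to_fract f oo fps_to_fract g"
  by (simp add: fps_eq_iff fps_compose_nth flip: fps_to_fract_power)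

lemma range_fps_to_fract_iff:
  "f \<in> range fps_to_fract \<longleftrightarrow> (\<forall>n. fps_nth f n \<in> range to_fract)"
proof
  assume "\<forall>n. fps_nth f n \<in> range to_fract"
  then obtain c where "\<And>n. fps_nth f n = to_fract (c n)"
    unfolding image_iff by metis
  hence "f = fps_to_fract (Abs_fps c)"
    by (simp add: fps_eq_iff)
  thus "f \<in> range fps_to_fract"
    by simp
qed auto

section \<open>The Frobenius congruence modulo p\<close>

lemma of_nat_dvd_fps_nth:
  assumes "of_nat m dvd (f :: 'a::comm_ring_1 fps)"
  shows "of_nat m dvd fps_nth f n"
  using assms by (auto simp: dvd_def simp flip: fps_of_nat)

text \<open>A prime p divides every binomial coefficient of its row except the two outer ones, so
  only a^p and b^p survive modulo p.\<close>

lemma prime_dvd_power_add_diff: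
  fixes a b :: "'a::comm_ring_1"
  assumes "prime p"
  shows "of_nat p dvd (a + b) ^ p - (a ^ p + b ^ p)"
proof -
  have p: "0 < p" using assms prime_gt_0_nat by blast
  have split: "{..p} = insert 0 (insert p {0<..<p})"
    using p by auto
  have "(a + b) ^ p - (a ^ p + b ^ p) = (\<Sum>k\<in>{0<..<p}. of_nat (p choose k) * a ^ k * b ^ (p - k))"
    using p unfolding binomial_ring split by simp
  also have "of_nat p dvd \<dots>"
  proof (intro dvd_sum dvd_mult2)
    fix k assume "k \<in> {0<..<p}"
    hence "p dvd (p choose k)"
      using assms by (intro dvd_choose_prime) auto
    thus "of_nat p dvd (of_nat (p choose k) :: 'a)"
      by (auto elim: dvdE)
  qed
  finally show ?thesis .
qed

text \<open>Splitting off the constant coefficient, v = c + x w, reduces the claim for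
  \<open>v\<close> at n to the claim for \<open>w\<close> at n - p: the p-th power is additive
  modulo p, and c^p is congruent to c by the hypothesis on R.\<close>

lemma fps_frobenius_dvd_nth:
  fixes v :: "'a::idom fps"
  assumes p: "prime p" and frob: "\<And>a :: 'a. of_nat p dvd a ^ p - a"
  shows "of_nat p dvd fps_nth (v ^ p - (v oo fps_X ^ p)) n"
proof (induction n arbitrary: v rule: less_induct)
  case (less n)
  have p0: "p > 0" using p prime_gt_0_nat by blast
  define c w where "c = fps_nth v 0" and "w = fps_shift 1 v"
  have v: "v = fps_const c + fps_X * w"
    using fps_shift_cutoff[of 1 v] by (auto simp: fps_eq_iff c_def w_def)
  have "v oo fps_X ^ p = fps_const c + fps_X ^ p * (w oo fps_X ^ p)"
    using p0 unfolding v by (simp add: fps_compose_add_distrib fps_compose_mult_distrib)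
  hence "v ^ p - (v oo fps_X ^ p) =
      ((fps_const c + fps_X * w) ^ p - (fps_const c ^ p + (fps_X * w) ^ p))
      + fps_const (c ^ p - c) + fps_X ^ p * (w ^ p - (w oo fps_X ^ p))"
    by (simp add: v algebra_simps flip: fps_const_sub)
  moreover have "of_nat p dvd fps_nth (fps_const (c ^ p - c)) n"
    using frob by simp
  \<comment> \<open>Below degree p this coefficient vanishes; otherwise n - p < n and the induction
    hypothesis applies to \<open>w\<close>.\<close>
  moreover have "of_nat p dvd fps_nth (fps_X ^ p * (w ^ p - (w oo fps_X ^ p))) n"
    using less[of "n - p" w] p0 by (simp add: fps_X_power_mult_nth)
  ultimately show ?case
    using of_nat_dvd_fps_nth[OF prime_dvd_power_add_diff[OF p]]
    by (simp only: fps_add_nth) (intro dvd_add)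
qed

section \<open>Congruence modulo x^n, expressed by equality of cutoffs, and the coefficient of
  x^n\<close>

lemma fps_cutoff_eq_iff:
  "fps_cutoff n u = fps_cutoff n v \<longleftrightarrow> (\<forall>k<n. fps_nth u k = fps_nth v k)"
  by (auto simp: fps_eq_iff)

lemma fps_cutoff_mult_cong:
  assumes "fps_cutoff n u = fps_cutoff n u'" "fps_cutoff n v = fps_cutoff n v'"
  shows "fps_cutoff n (u * v) = fps_cutoff n (u' * v')"
  using assms by (auto simp: fps_cutoff_eq_iff fps_mult_nth intro!: sum.cong)

lemma fps_cutoff_power_cong:
  assumes "fps_cutoff n u = fps_cutoff n v"
  shows "fps_cutoff n (u ^ i) = fps_cutoff n (v ^ i)"
  by (induction i) (auto intro: fps_cutoff_mult_cong[OF assms])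

lemma fps_cutoff_compose_cong:
  assumes "fps_cutoff n u = fps_cutoff n v"
  shows "fps_cutoff n (g oo u) = fps_cutoff n (g oo v)"
  using fps_cutoff_power_cong[OF assms] by (simp add: fps_cutoff_eq_iff fps_compose_nth)

text \<open>In the factorisation u^m - v^m = (u - v) t with u - v = x^n s, only the constant
  coefficient of \<open>t\<close> reaches degree n. It is m, because \<open>u\<close> (as n > 0) and
  \<open>v\<close> have constant coefficient 1.\<close>

lemma fps_power_nth_add_top:
  fixes v s :: "'a::comm_ring_1 fps"
  assumes "n > 0" "fps_nth v 0 = 1"
  shows "fps_nth ((v + fps_X ^ n * s) ^ m) n = fps_nth (v ^ m) n + of_nat m * fps_nth s 0"
proof (cases m)
  case (Suc m')
  define u where "u = v + fps_X ^ n * s"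
  define t where "t = (\<Sum>i<Suc m'. u ^ i * v ^ (m' - i))"
  have "fps_nth u 0 = 1"
    using assms by (simp add: u_def)
  hence "fps_nth t 0 = of_nat m"
    using assms by (simp add: t_def Suc fps_sum_nth fps_power_zeroth del: sum.lessThan_Suc)
  moreover have "u ^ m - v ^ m = fps_X ^ n * (s * t)"
    unfolding Suc diff_power_eq_sum t_def by (simp add: u_def mult.assoc)
  hence "fps_nth (u ^ m - v ^ m) n = fps_nth s 0 * fps_nth t 0"
    by (simp add: fps_X_power_mult_nth)
  ultimately show ?thesis
    by (simp add: u_def algebra_simps)
qed simp

text \<open>A term u_i x^(m i) contributes in degree n only if m i = n, which forces i < n since m
  \<ge> 2 and n > 0.\<close>

lemma fps_cutoff_compose_X_power_nth:
  fixes u :: "'a::comm_ring_1 fps"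
  assumes "m \<ge> 2" "n > 0"
  shows "fps_nth (u oo fps_X ^ m) n = fps_nth (fps_cutoff n u oo fps_X ^ m) n"
proof -
  have "fps_nth u i * fps_nth ((fps_X ^ m) ^ i) n
      = fps_nth (fps_cutoff n u) i * fps_nth ((fps_X ^ m) ^ i :: 'a fps) n" for i
  proof (cases "i < n")
    case False
    have "2 * i \<le> m * i" using assms by simp
    hence "n \<noteq> m * i" using False assms by linarith
    thus ?thesis by (simp flip: power_mult)
  qed simp
  thus ?thesis by (simp add: fps_compose_nth)
qed

section \<open>Integrality of the Boettcher coordinate\<close>

lemma bottcher_quotient_equation:
  fixes g u :: "'a::field_char_0 fps"
  assumes p: "p > 0"
    and "is_bottcher p (fps_X ^ p + of_nat p * fps_X ^ (p + 1) * g) (fps_X * u)"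
  shows "u ^ p + of_nat p * (fps_X * (u ^ (p + 1) * (g oo (fps_X * u)))) = u oo fps_X ^ p"
proof -
  \<comment> \<open>Both sides of the functional equation carry a factor x^p, which cancels; from (x
    u)^(p+1) one factor x remains.\<close>
  have "(fps_X ^ p + of_nat p * fps_X ^ (p + 1) * g) oo (fps_X * u)
      = fps_X ^ p * (u ^ p + of_nat p * (fps_X * (u ^ (p + 1) * (g oo (fps_X * u)))))"
    by (simp add: fps_compose_add_distrib fps_compose_mult_distrib algebra_simps
        flip: fps_compose_power fps_of_nat)
  moreover have "(fps_X * u) oo fps_X ^ p = fps_X ^ p * (u oo fps_X ^ p)"
    using p by (simp add: fps_compose_mult_distrib)
  ultimately show ?thesis
    using assms(2) by (simp add: is_bottcher_def)
qed

lemma bottcher_integral: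
  fixes g :: "'r::{idom,ring_char_0} fps"
  assumes p: "prime p" and frob: "\<And>a :: 'r. of_nat p dvd a ^ p - a"
    and f: "is_bottcher p (fps_X ^ p + of_nat p * fps_X ^ (p + 1) * fps_to_fract g) f"
  shows "f \<in> range fps_to_fract"
proof -
  have p2: "p \<ge> 2" using p prime_ge_2_nat by blast
  define G u where "G = fps_to_fract g" and "u = fps_shift 1 f"
  have f_eq: "f = fps_X * u"
    using f by (auto simp: is_bottcher_def u_def fps_eq_iff)
  have u0: "fps_nth u 0 = 1"
    using f by (simp add: is_bottcher_def u_def)
  have eq: "u ^ p + of_nat p * (fps_X * (u ^ (p + 1) * (G oo (fps_X * u)))) = u oo fps_X ^ p"
    using bottcher_quotient_equation[of p G u] f p2 by (simp add: f_eq G_def)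
  have "fps_nth u n \<in> range to_fract" for n
  proof (induction n rule: less_induct)
    case (less n)
    show ?case
    proof (cases "n = 0")
      case True
      thus ?thesis using u0 by (metis rangeI to_fract_1)
    next
      case False
      \<comment> \<open>From index n on, the coefficients of the cutoff are 0, the image of 0, so
        the whole truncation lifts to R[[x]].\<close>
      have "fps_nth (fps_cutoff n u) k \<in> range to_fract" for k
        using less[of k] by (cases "k < n") (auto simp: image_iff intro: exI[of _ 0])
      then obtain v where v: "fps_cutoff n u = fps_to_fract v"
        using range_fps_to_fract_iff by blast
      define V where "V = fps_to_fract v"
      have V0: "fps_nth V 0 = 1"
        using u0 False by (simp add: V_def flip: v)
      \<comment> \<open>This is the lift to R[[x]] of u^(p+1) g(x u) with \<open>u\<close> replaced
        by its truncation. The factor x in front of that term in \<open>eq\<close> lowers the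
        relevant index to n - 1, where the replacement changes nothing.\<close>
      define h where "h = v ^ (p + 1) * (g oo (fps_X * v))"
      have "fps_cutoff n u = fps_cutoff n V"
        by (simp add: V_def fps_eq_iff flip: v)
      hence "fps_cutoff n (u ^ (p + 1) * (G oo (fps_X * u)))
          = fps_cutoff n (V ^ (p + 1) * (G oo (fps_X * V)))"
        by (intro fps_cutoff_mult_cong fps_cutoff_power_cong fps_cutoff_compose_cong) auto
      also have "V ^ (p + 1) * (G oo (fps_X * V)) = fps_to_fract h"
        by (simp add: h_def V_def G_def)
      finally have h: "fps_nth (u ^ (p + 1) * (G oo (fps_X * u))) (n - 1) = to_fract (fps_nth h (n - 1))"
        using False by (auto simp: fps_cutoff_eq_iff)
      \<comment> \<open>The first coefficient dropped by the cutoff is u_n; it enters the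
        coefficient of x^n in u^p linearly, with factor p.\<close>
      have "u = V + fps_X ^ n * fps_shift n u"
        using fps_shift_cutoff[of n u] by (simp add: v V_def algebra_simps)
      hence "fps_nth (u ^ p) n = fps_nth (V ^ p) n + of_nat p * fps_nth u n"
        using fps_power_nth_add_top[of n V "fps_shift n u" p] False V0 by simp
      moreover have "fps_nth (u oo fps_X ^ p) n = fps_nth (V oo fps_X ^ p) n"
        using fps_cutoff_compose_X_power_nth[OF p2, of n u] False by (simp add: v V_def)
      moreover have "fps_nth (u ^ p) n + of_nat p * to_fract (fps_nth h (n - 1))
          = fps_nth (u oo fps_X ^ p) n"
        using False h unfolding eq[symmetric] by (simp flip: fps_of_nat)
      \<comment> \<open>The Frobenius congruence holds over R with quotient \<open>r\<close>; the
        next two facts carry it over to K.\<close>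
      moreover obtain r where "fps_nth (v ^ p - (v oo fps_X ^ p)) n = of_nat p * r"
        using fps_frobenius_dvd_nth[OF p frob] by (metis dvdE)
      hence "to_fract (fps_nth (v ^ p) n - fps_nth (v oo fps_X ^ p) n) = of_nat p * to_fract r"
        by (simp only: fps_sub_nth to_fract_mult to_fract_of_nat)
      hence "fps_nth (V ^ p) n - fps_nth (V oo fps_X ^ p) n = of_nat p * to_fract r"
        unfolding V_def by (simp only: to_fract_diff fps_to_fract_X
          flip: fps_to_fract_nth fps_to_fract_power fps_to_fract_compose)
           (simp only: fps_to_fract_power fps_to_fract_compose fps_to_fract_X)
      ultimately have "of_nat p * (fps_nth u n + to_fract (r + fps_nth h (n - 1))) = 0"
        by (simp add: algebra_simps)
      \<comment> \<open>The factor p cancels because K has characteristic 0.\<close>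
      hence "fps_nth u n = to_fract (- (r + fps_nth h (n - 1)))"
        using p2 by (simp only: to_fract_uminus eq_neg_iff_add_eq_0 mult_eq_0_iff of_nat_eq_0_iff) auto
      thus ?thesis by blast
    qed
  qed
  then obtain w where "u = fps_to_fract w"
    using range_fps_to_fract_iff by blast
  hence "f = fps_to_fract (fps_X * w)"
    by (simp add: f_eq)
  thus ?thesis by blast
qed

section \<open>Integrality of the compositional inverse\<close>

lemma fps_inv_integral:
  assumes "fps_nth (fps_to_fract F) 1 = 1"
  shows "fps_inv (fps_to_fract F) \<in> range fps_to_fract"
proof -
  have "compinv (fps_to_fract F) n \<in> range to_fract" for n
  proof (induction n rule: less_induct)
    case (less n)
    show ?case
    proof (cases n)
      case 0
      thus ?thesis by (simp add: image_iff exI[of _ 0])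
    next
      case (Suc m)
      have "\<forall>i\<in>{0..m}. \<exists>c. compinv (fps_to_fract F) i = to_fract c"
        using less Suc by (auto simp: image_iff)
      then obtain c where c: "\<And>i. i \<in> {0..m} \<Longrightarrow> compinv (fps_to_fract F) i = to_fract (c i)"
        by metis
      \<comment> \<open>The recursion for \<open>compinv\<close> divides by a power of the linear
        coefficient, here 1, so only ring operations on lifted coefficients remain.\<close>
      have "compinv (fps_to_fract F) n
          = to_fract (fps_nth fps_X n - (\<Sum>i=0..m. c i * fps_nth (F ^ i) n))"
        using assms by (simp add: Suc c flip: fps_to_fract_power)
      thus ?thesis by blast
    qed
  qed
  thus ?thesis
    by (simp add: range_fps_to_fract_iff fps_inv_def)
qed

theorem theorem4:
  fixes p :: nat and \<phi> :: "'r::{idom,ring_char_0} fps"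
  assumes "prime p"
    and "\<And>a :: 'r. of_nat p dvd a ^ p - a"
    and "\<exists>g. \<phi> = fps_X ^ p + of_nat p * fps_X ^ (p + 1) * g"
  shows "bottcher p (fps_to_fract \<phi>) \<in> range fps_to_fract
    \<and> fps_inv (bottcher p (fps_to_fract \<phi>)) \<in> range fps_to_fract"
proof -
  obtain g where \<phi>: "\<phi> = fps_X ^ p + of_nat p * fps_X ^ (p + 1) * g"
    using assms(3) ..
  define f where "f = bottcher p (fps_to_fract \<phi>)"
  have eq: "fps_to_fract \<phi> = fps_X ^ p + of_nat p * fps_X ^ (p + 1) * fps_to_fract g"
    by (simp add: \<phi>)
  \<comment> \<open>Existence of the coordinate is stated for the shape x^p + x^(p+1) g', so p is
    absorbed into the cofactor over K.\<close>
  also have "\<dots> = fps_X ^ p + fps_X ^ (p + 1) * (of_nat p * fps_to_fract g)"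
    by (simp only: mult_ac)
  finally have f: "is_bottcher p (fps_to_fract \<phi>) f"
    unfolding f_def using assms(1) by (intro is_bottcher_bottcher prime_ge_2_nat) blast+
  hence int: "f \<in> range fps_to_fract"
    unfolding eq using assms(1,2) by (intro bottcher_integral)
  then obtain F where "f = fps_to_fract F" ..
  hence "fps_inv f \<in> range fps_to_fract"
    using f fps_inv_integral[of F] by (simp add: is_bottcher_def)
  with int show ?thesis
    by (simp add: f_def)
qed

end
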